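(* Let $A$ be a finite-dimensional nilpotent Leibniz algebra over a field $\mathbb{F}$ with coclass $cc(A)=0$. Then $A$ is cyclic, or $\dim(A)\le 1$.
   Context: A (left) Leibniz algebra over a field $\mathbb{F}$ is an $\mathbb{F}$-vector space $A$ with a bilinear map $[\,,]:A\times A\to A$ satisfying $[a,[b,c]]=[[a,b],c]+[b,[a,c]]$ for all $a,b,c$. Lower central series: $A^1=A$, $A^{i+1}=[A,A^i]$. $A$ is nilpotent of class $c=cl(A)$ if $A^{c+1}=0$ and $A^c\ne 0$. The coclass is $cc(A)=\dim(A)-cl(A)$. $A$ is cyclic if it is generated as an algebra by a single element. *)

theory Defs
  imports Main "HOL.Vector_Spaces" "HOL.Hull"
begin

locale leibniz_algebra = vector_space scale
  for scale :: "'f::field \<Rightarrow> 'a::ab_group_add \<Rightarrow> 'a" (infixr \<open>*s\<close> 75) +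
  fixes bracket :: "'a \<Rightarrow> 'a \<Rightarrow> 'a"
  assumes linear_bracket_right: "Vector_Spaces.linear scale scale (\<lambda>y. bracket x y)"
    and linear_bracket_left: "Vector_Spaces.linear scale scale (\<lambda>x. bracket x y)"
    and left_leibniz: "bracket a (bracket b c) = bracket (bracket a b) c + bracket b (bracket a c)"
begin

definition product :: "'a set \<Rightarrow> 'a set \<Rightarrow> 'a set"
  where "product U V = span {bracket u v | u v. u \<in> U \<and> v \<in> V}"

(* The series is indexed from 1, as usual; the value at 0 is a dummy. *)
fun lower_central :: "nat \<Rightarrow> 'a set"
  where
    "lower_central 0 = UNIV"
  | "lower_central (Suc 0) = UNIV"
  | "lower_central (Suc (Suc i)) = product UNIV (lower_central (Suc i))"

definition nilpotent :: bool
  where "nilpotent \<longleftrightarrow> (\<exists>c. lower_central (c + 1) = {0})"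

(* For a nonzero nilpotent algebra this is the unique c with A^(c+1) = 0 and A^c nonzero
   (lemma nilpotency_class_eq_iff); the zero algebra gets class 0. *)
definition nilpotency_class :: nat
  where "nilpotency_class = (LEAST c. lower_central (c + 1) = {0})"

(* Integer-valued, to avoid truncated subtraction. *)
definition coclass :: int
  where "coclass = int (dim (UNIV :: 'a set)) - int nilpotency_class"

definition subalgebra :: "'a set \<Rightarrow> bool"
  where "subalgebra B \<longleftrightarrow> subspace B \<and> (\<forall>x\<in>B. \<forall>y\<in>B. bracket x y \<in> B)"

definition cyclic :: bool
  where "cyclic \<longleftrightarrow> (\<exists>a. subalgebra hull {a} = UNIV)"

lemma lower_central_eq_0_mono:
  assumes "lower_central (Suc i) = {0}" and "i \<le> j"
  shows "lower_central (Suc j) = {0}"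
  using assms(2)
proof (induction j rule: dec_induct)
  case base
  show ?case by (rule assms(1))
next
  case (step n)
  have "bracket u 0 = 0" for u
    using linear_bracket_right[of u]
    by (simp add: linear_iff_module_hom module_hom.zero)
  then have "{bracket u v | u v. u \<in> UNIV \<and> v \<in> {0}} = {0}"
    by auto
  then show ?case
    using step by (simp add: product_def)
qed

lemma nilpotency_class_eq_iff:
  assumes "nilpotent" and "c \<ge> 1"
  shows "nilpotency_class = c \<longleftrightarrow> lower_central (c + 1) = {0} \<and> lower_central c \<noteq> {0}"
proof
  assume c: "nilpotency_class = c"
  have "lower_central (nilpotency_class + 1) = {0}"
    using assms(1) unfolding nilpotent_def nilpotency_class_def by (rule LeastI_ex)
  moreover have "lower_central (c - 1 + 1) \<noteq> {0}"
    using c assms(2) not_less_Least[of "c - 1" "\<lambda>c. lower_central (c + 1) = {0}"]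
    unfolding nilpotency_class_def by auto
  ultimately show "lower_central (c + 1) = {0} \<and> lower_central c \<noteq> {0}"
    using c assms(2) by simp
next
  assume c: "lower_central (c + 1) = {0} \<and> lower_central c \<noteq> {0}"
  show "nilpotency_class = c"
    unfolding nilpotency_class_def
  proof (rule Least_equality)
    show "lower_central (c + 1) = {0}" using c by simp
    fix d assume d: "lower_central (d + 1) = {0}"
    show "c \<le> d"
    proof (rule ccontr)
      assume "\<not> c \<le> d"
      then have "d \<le> c - 1" by simp
      then have "lower_central (Suc (c - 1)) = {0}"
        using lower_central_eq_0_mono d by simp
      then show False using c assms(2) by simp
    qed
  qed
qed

end

end

theory Submission imports Defs
begin

text \<open>
  Coclass zero forces every step of the lower central series down to \<open>0\<close> to have codimension one,
  so \<open>A\<close> is spanned by some \<open>a\<close> together with \<open>A\<^sup>2\<close>. In a nilpotent Leibniz algebra,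
  a subalgebra \<open>B\<close> with \<open>B + A\<^sup>2 = A\<close> is everything: since \<open>[A\<^sup>2, A\<^sup>i] \<subseteq> A\<^sup>i\<^sup>+\<^sup>2\<close>, each \<open>A\<^sup>i\<close> is
  contained in \<open>(B \<inter> A\<^sup>i) + A\<^sup>i\<^sup>+\<^sup>1\<close>, and descending induction from \<open>A\<^sup>c\<^sup>+\<^sup>1 = 0\<close> gives \<open>A\<^sup>i \<subseteq> B\<close>.
\<close>

context leibniz_algebra
begin

lemma bracket_add_right: "bracket x (y + z) = bracket x y + bracket x z"
  using module_hom.add[OF linear_bracket_right[of x, unfolded linear_iff_module_hom]] .

lemma bracket_add_left: "bracket (x + y) z = bracket x z + bracket y z"
  using module_hom.add[OF linear_bracket_left[of z, unfolded linear_iff_module_hom]] .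

lemma bracket_diff_right: "bracket x (y - z) = bracket x y - bracket x z"
  using module_hom.diff[OF linear_bracket_right[of x, unfolded linear_iff_module_hom]] .

lemma bracket_diff_left: "bracket (x - y) z = bracket x z - bracket y z"
  using module_hom.diff[OF linear_bracket_left[of z, unfolded linear_iff_module_hom]] .

lemma bracket_scale_left: "bracket (r *s x) z = r *s bracket x z"
  using module_hom.scale[OF linear_bracket_left[of z, unfolded linear_iff_module_hom]] .

lemma bracket_zero_left: "bracket 0 z = 0"
  using bracket_diff_left[of 0 0 z] by simp

lemma subspace_lower_central: "subspace (lower_central i)"
  by (induction i rule: lower_central.induct) (auto simp: product_def)

lemma lower_central_Suc_Suc: "lower_central (Suc (Suc i)) =
    span {bracket u v | u v. v \<in> lower_central (Suc i)}"
  by (simp add: product_def)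

lemma bracket_in_lower_central:
  "v \<in> lower_central (Suc i) \<Longrightarrow> bracket u v \<in> lower_central (Suc (Suc i))"
  unfolding lower_central_Suc_Suc by (rule span_base) blast

lemma lower_central_Suc_subset: "lower_central (Suc (Suc i)) \<subseteq> lower_central (Suc i)"
proof (induction i)
  case (Suc i)
  show ?case
    by (subst (1 2) lower_central_Suc_Suc, rule span_mono) (use Suc in blast)
qed simp

text \<open>Each term is computed from the preceding one alone, so a single repetition freezes the
  series from there on.\<close>

lemma lower_central_stationary:
  assumes "lower_central (Suc (Suc i)) = lower_central (Suc i)" and "i \<le> j"
  shows "lower_central (Suc j) = lower_central (Suc i)"
  using assms(2) by (induction j rule: dec_induct) (simp_all add: assms(1)[simplified])

text \<open>Solving the Leibniz identity for \<open>[[x,y],v]\<close> turns a left product with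
  \<open>[x,y]\<close> into a difference of two successive left products, each of which descends one
  step; hence the gain of two.\<close>

lemma bracket_square_lower_central:
  assumes "w \<in> lower_central 2" and "v \<in> lower_central (Suc i)"
  shows "bracket w v \<in> lower_central (Suc (Suc (Suc i)))"
proof -
  have "w \<in> span {bracket x y | x y. True}"
    using assms(1) by (simp add: numeral_2_eq_2 product_def)
  then show ?thesis
  proof (induction w rule: span_induct_alt)
    case base
    show ?case
      by (simp add: bracket_zero_left subspace_0[OF subspace_lower_central] del: lower_central.simps)
  next
    case (step r b w)
    then obtain x y where b: "b = bracket x y" by blast
    have "bracket b v = bracket x (bracket y v) - bracket y (bracket x v)"
      unfolding b by (simp add: left_leibniz[of x y v])
    also have "\<dots> \<in> lower_central (Suc (Suc (Suc i)))"
      by (intro subspace_diff subspace_lower_central bracket_in_lower_central assms(2))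
    finally show ?case
      unfolding bracket_add_left bracket_scale_left
      by (intro subspace_add subspace_scale subspace_lower_central step.IH)
  qed
qed

lemma lower_central_approx_subalgebra:
  assumes B: "subalgebra B" and gen: "\<And>x. \<exists>b\<in>B. x - b \<in> lower_central 2"
    and "x \<in> lower_central (Suc i)"
  shows "\<exists>b\<in>B \<inter> lower_central (Suc i). x - b \<in> lower_central (Suc (Suc i))"
  using assms(3)
proof (induction i arbitrary: x)
  case 0
  show ?case using gen[of x] by (simp add: numeral_2_eq_2)
next
  case (Suc i)
  let ?L = "\<lambda>k. lower_central (Suc k)"
  have subB: "subspace B" and mult: "\<And>x y. x \<in> B \<Longrightarrow> y \<in> B \<Longrightarrow> bracket x y \<in> B"
    using B by (auto simp: subalgebra_def)
  note sub = subB subspace_lower_central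
  have "x \<in> span {bracket u v | u v. v \<in> ?L i}"
    using Suc.prems unfolding lower_central_Suc_Suc .
  then show ?case
  proof (induction x rule: span_induct_alt)
    case base
    show ?case
      by (rule bexI[of _ 0]) (auto intro: subspace_0 sub simp del: lower_central.simps)
  next
    case (step r x y)
    then obtain u v where x: "x = bracket u v" and v: "v \<in> ?L i" by blast
    obtain b where b: "b \<in> B" "u - b \<in> lower_central 2" using gen by blast
    obtain b' where b': "b' \<in> B" "b' \<in> ?L i" "v - b' \<in> ?L (Suc i)" using Suc.IH[OF v] by blast
    obtain c where c: "c \<in> B" "c \<in> ?L (Suc i)" "y - c \<in> ?L (Suc (Suc i))"
      using step.IH by blast
    \<comment> \<open>Both errors land equally deep: the first descends two steps because
      \<open>u - b\<close> lies in \<open>lower_central 2\<close>, the second only one, but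
      \<open>v - b'\<close> already starts one step lower than \<open>v\<close>.\<close>
    have "x - bracket b b' = bracket (u - b) v + bracket b (v - b')"
      unfolding x by (simp add: bracket_diff_left bracket_diff_right)
    also have "\<dots> \<in> ?L (Suc (Suc i))"
      by (intro subspace_add sub bracket_square_lower_central bracket_in_lower_central b b' v)
    finally have "r *s (x - bracket b b') + (y - c) \<in> ?L (Suc (Suc i))"
      by (intro subspace_add subspace_scale sub c)
    then have "(r *s x + y) - (r *s bracket b b' + c) \<in> ?L (Suc (Suc i))"
      by (simp add: scale_right_diff_distrib algebra_simps del: lower_central.simps)
    moreover have "r *s bracket b b' + c \<in> B"
      by (intro subspace_add subspace_scale sub mult b b' c)
    moreover have "r *s bracket b b' + c \<in> ?L (Suc i)"
      by (intro subspace_add subspace_scale sub bracket_in_lower_central b' c)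
    ultimately show ?case by blast
  qed
qed

text \<open>Counterpart of the fact that a subgroup of a nilpotent group mapping onto the
  abelianization is the whole group.\<close>

lemma nilpotent_subalgebra_eq_UNIV:
  assumes nilpotent and B: "subalgebra B" and gen: "\<And>x. \<exists>b\<in>B. x - b \<in> lower_central 2"
  shows "B = UNIV"
proof -
  have subB: "subspace B" using B by (simp add: subalgebra_def)
  obtain c where c: "lower_central (Suc c) = {0}"
    using assms(1) by (auto simp: nilpotent_def)
  have "lower_central (Suc 0) \<subseteq> B"
  proof (rule inc_induct[of 0 c])
    show "lower_central (Suc c) \<subseteq> B" using c subspace_0[OF subB] by simp
  next
    fix i assume IH: "lower_central (Suc (Suc i)) \<subseteq> B"
    show "lower_central (Suc i) \<subseteq> B"
    proof
      fix x assume "x \<in> lower_central (Suc i)"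
      then obtain b where "b \<in> B" "x - b \<in> B"
        using lower_central_approx_subalgebra[OF B gen] IH by blast
      then show "x \<in> B" using subspace_add[OF subB, of "x - b" b] by simp
    qed
  qed simp
  then show ?thesis by auto
qed

lemma subalgebra_hull: "subalgebra (subalgebra hull S)"
  by (rule hull_in)
    (auto simp: subalgebra_def intro!: subspace_Inter)

text \<open>The multiples of \<open>a\<close> lie in the subalgebra generated by \<open>a\<close>
  and already represent every element modulo \<open>lower_central 2\<close>.\<close>

lemma nilpotent_cyclicI:
  assumes nilpotent and span: "span (insert a (lower_central 2)) = UNIV"
  shows cyclic
proof -
  let ?B = "subalgebra hull {a}"
  have "a \<in> ?B" by (rule hull_inc) simp
  have "\<exists>b\<in>?B. x - b \<in> lower_central 2" for x
  proof -
    have "x \<in> span (insert a (lower_central 2))" by (simp add: span)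
    then obtain k where "x - k *s a \<in> span (lower_central 2)"
      by (auto simp: span_insert)
    then have "x - k *s a \<in> lower_central 2"
      using span_eq_iff subspace_lower_central by metis
    moreover have "k *s a \<in> ?B"
      using subalgebra_hull \<open>a \<in> ?B\<close> by (auto simp: subalgebra_def intro: subspace_scale)
    ultimately show ?thesis by blast
  qed
  then have "?B = UNIV" by (rule nilpotent_subalgebra_eq_UNIV[OF assms(1) subalgebra_hull])
  then show ?thesis by (auto simp: cyclic_def)
qed

text \<open>An equality would freeze the series at a nonzero term, although it reaches
  \<open>{0}\<close> at index \<open>Suc nilpotency_class\<close>.\<close>

lemma lower_central_psubset:
  assumes nilpotent and "i < nilpotency_class"
  shows "lower_central (Suc (Suc i)) \<subset> lower_central (Suc i)"
proof -
  have "lower_central (Suc i) \<noteq> {0}"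
    using not_less_Least assms(2) unfolding nilpotency_class_def by fastforce
  moreover have "lower_central (Suc nilpotency_class) = {0}"
    using LeastI_ex[OF assms(1)[unfolded nilpotent_def]] by (simp add: nilpotency_class_def)
  ultimately have "lower_central (Suc (Suc i)) \<noteq> lower_central (Suc i)"
    using lower_central_stationary[of i nilpotency_class] assms(2) by auto
  then show ?thesis using lower_central_Suc_subset by blast
qed

text \<open>Each of the \<open>nilpotency_class - i\<close> strict inclusions below this term costs
  at least one dimension. The bound is stated additively to avoid truncated subtraction.\<close>

lemma dim_lower_central_ge:
  assumes fin: "finite_dimensional_vector_space scale Basis" and nilpotent
    and "i \<le> nilpotency_class"
  shows "nilpotency_class \<le> dim (lower_central (Suc i)) + i"
  using assms(3)
proof (induction i rule: inc_induct)
  case (step i)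
  interpret finite_dimensional_vector_space scale Basis by (fact fin)
  have "span (lower_central (Suc (Suc i))) \<subset> span (lower_central (Suc i))"
    using lower_central_psubset[OF assms(2) step.hyps(2)] span_eq_iff subspace_lower_central
    by metis
  then have "dim (lower_central (Suc (Suc i))) < dim (lower_central (Suc i))"
    by (rule dim_psubset)
  then show ?case using step.IH by simp
qed simp

lemma coclass_0_span:
  assumes fin: "finite_dimensional_vector_space scale Basis" and nilpotent
    and "coclass = 0" and "dim UNIV \<noteq> 0"
  obtains a where "span (insert a (lower_central 2)) = UNIV"
proof -
  interpret finite_dimensional_vector_space scale Basis by (fact fin)
  have cl: "nilpotency_class = dim UNIV" using assms(3) by (simp add: coclass_def)
  \<comment> \<open>Nonzero dimension makes the class positive, so the first step of the series is
    strict.\<close>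
  then have "lower_central 2 \<subset> UNIV"
    using lower_central_psubset[OF assms(2), of 0] cl assms(4) by (simp add: numeral_2_eq_2)
  then obtain a where "a \<notin> lower_central 2" by blast
  then have "a \<notin> span (lower_central 2)" using span_eq_iff subspace_lower_central by metis
  then have "dim (insert a (lower_central 2)) = dim (lower_central 2) + 1"
    by (simp add: dim_insert)
  \<comment> \<open>Class equal to dimension leaves \<open>lower_central 2\<close> with codimension
    at most one, so any \<open>a\<close> outside it completes a spanning set.\<close>
  moreover have "dim UNIV \<le> dim (lower_central 2) + 1"
    using dim_lower_central_ge[OF fin assms(2), of 1] cl assms(4) by (simp add: numeral_2_eq_2)
  ultimately have "dim UNIV \<le> dim (insert a (lower_central 2))" by simp
  then have "span (insert a (lower_central 2)) = span UNIV"
    by (intro dim_eq_span) auto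
  then show ?thesis using that by simp
qed

end

theorem proposition3p4:
  fixes scale :: "'f::field \<Rightarrow> 'a::ab_group_add \<Rightarrow> 'a"
    and bracket :: "'a \<Rightarrow> 'a \<Rightarrow> 'a"
    and Basis :: "'a set"
  assumes "leibniz_algebra scale bracket"
    and "finite_dimensional_vector_space scale Basis"
    and "leibniz_algebra.nilpotent scale bracket"
    and "leibniz_algebra.coclass scale bracket = 0"
  shows "leibniz_algebra.cyclic scale bracket \<or> vector_space.dim scale (UNIV :: 'a set) \<le> 1"
proof -
  interpret leibniz_algebra scale bracket by (fact assms(1))
  show ?thesis
  \<comment> \<open>Dimension 0 falls under the second alternative; from dimension 1 on a generator
    is found outside \<open>lower_central 2\<close>.\<close>
  proof (cases "dim (UNIV :: 'a set) = 0")
    case False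
    then obtain a where "span (insert a (lower_central 2)) = UNIV"
      using coclass_0_span assms(2-4) by blast
    then show ?thesis using nilpotent_cyclicI[OF assms(3)] by blast
  qed simp
qed

end
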